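(* Let $X$ be a set. Then $\mathcal{C},\mathcal{U}:\mathcal{P}(X)^{op}\to\mathcal{F}ilt(X)$ and $\ell:\mathcal{F}ilt(X)\to\mathcal{P}(X)^{op}$ are monotone maps, and they satisfy the following properties: (i) $\ell\circ\mathcal{C}=id=\ell\circ\mathcal{U}$. (ii) There are adjunctions $\mathcal{C}\dashv\ell\dashv\mathcal{U}:\mathcal{P}(X)^{op}\to\mathcal{F}ilt(X)$, i.e. $\mathcal{C}$ is left adjoint to $\ell$ and $\ell$ is left adjoint to $\mathcal{U}$. (iii) $\mathcal{C}(A\cup\ell(\mathcal{F}))=\mathcal{C}(A)\cap\mathcal{F}$ for all $A\subseteq X$ and all $\mathcal{F}\in\mathcal{F}ilt(X)$ (Frobenius relation). (iv) $\mathcal{U}\circ\ell=\big(c\mathcal{K}(X)\to(-)\big)$, and this map is the double negation $\neg\neg$ in $\mathcal{F}ilt(X)$. (v) A filter $\mathcal{F}$ on $X$ is $\neg\neg$-dense if, and only if, $\ell(\mathcal{F})=\emptyset$. (vi) $\mathcal{F}ilt(X)_{\neg\neg}\cong\mathcal{P}(X)^{op}\cong\{\mathcal{F}\in\mathcal{F}ilt(X);\ \mathcal{F}\subseteq c\mathcal{K}(X)\}$.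
   Context: $\mathcal{P}(X)$ is the set of all subsets of $X$ ordered by inclusion, and $\mathcal{P}(X)^{op}$ is the same set with the reverse order. A filter on $X$ is a nonempty family $\mathcal{F}$ of subsets of $X$ closed under finite intersections and under passing to supersets (so $\mathcal{P}(X)$ itself is a filter). $\mathcal{F}ilt(X)$ is the set of all filters on $X$ ordered by inclusion; it is a complete lattice in which finite meets distribute over arbitrary joins (a frame/locale, hence a complete Heyting algebra), with meet given by intersection, bottom element $\{X\}$ and top element $\mathcal{P}(X)$. The implication $\mathcal{F}\to\mathcal{G}$ is the Heyting implication in $\mathcal{F}ilt(X)$ (the largest filter $\mathcal{H}$ with $\mathcal{H}\cap\mathcal{F}\subseteq\mathcal{G}$), and $\neg\mathcal{F}=(\mathcal{F}\to\{X\})$. A filter $\mathcal{F}$ is $\neg\neg$-dense if $\neg\neg\mathcal{F}=\mathcal{P}(X)$, and $\mathcal{F}ilt(X)_{\neg\neg}=\{\mathcal{F}\in\mathcal{F}ilt(X);\neg\neg\mathcal{F}=\mathcal{F}\}$, ordered by inclusion. $c\mathcal{K}(X)$ is the filter of all cofinite subsets of $X$ (subsets with finite complement). For $A\subseteq X$: $\mathcal{U}(A)=\{U\subseteq X;A\subseteq U\}$ and $\mathcal{C}(A)=c\mathcal{K}(X)\cap\mathcal{U}(A)$, the filter of all cofinite subsets of $X$ containing $A$. For a filter $\mathcal{F}$, its limit is $\ell(\mathcal{F})=\bigcap_{U\in\mathcal{F}}U$. For monotone maps $f:P\to Q$, $g:Q\to P$ between posets, $f\dashv g$ ($f$ left adjoint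 to $g$) means $f(p)\leq q\iff p\leq g(q)$ for all $p\in P$, $q\in Q$. In (vi), $\cong$ denotes isomorphism of partially ordered sets (equivalently, of locales), and the last set is ordered by inclusion. *)

theory Defs
  imports "HOL-Algebra.Galois_Connection"
begin

text \<open>
  Filters are taken on a carrier set \<open>X\<close> (possibly empty), may be improper, and are ordered by
  inclusion of families. The library type \<open>'a filter\<close> is not used because it lives on a whole type
  and carries the reverse order.
\<close>

definition inclusion_order :: "'b set set \<Rightarrow> 'b set gorder"
  where "inclusion_order S = \<lparr>carrier = S, eq = (=), le = (\<subseteq>)\<rparr>"

definition filters_on :: "'a set \<Rightarrow> 'a set set set"
  where "filters_on X =
    {F. F \<subseteq> Pow X \<and> F \<noteq> {}
      \<and> (\<forall>U\<in>F. \<forall>V\<in>F. U \<inter> V \<in> F)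
      \<and> (\<forall>U\<in>F. \<forall>V. U \<subseteq> V \<and> V \<subseteq> X \<longrightarrow> V \<in> F)}"

abbreviation Filt :: "'a set \<Rightarrow> 'a set set gorder"
  where "Filt X \<equiv> inclusion_order (filters_on X)"

abbreviation Pow_op :: "'a set \<Rightarrow> 'a set gorder"
  where "Pow_op X \<equiv> inv_gorder (inclusion_order (Pow X))"

definition cofinite_filter :: "'a set \<Rightarrow> 'a set set"
  where "cofinite_filter X = {U. U \<subseteq> X \<and> finite (X - U)}"

definition up_filter :: "'a set \<Rightarrow> 'a set \<Rightarrow> 'a set set"
  where "up_filter X A = {U. U \<subseteq> X \<and> A \<subseteq> U}"

definition cofinite_up_filter :: "'a set \<Rightarrow> 'a set \<Rightarrow> 'a set set"
  where "cofinite_up_filter X A = cofinite_filter X \<inter> up_filter X A"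

definition filter_limit :: "'a set set \<Rightarrow> 'a set"
  where "filter_limit F = (\<Inter>U\<in>F. U)"

text \<open>
  Existence of the greatest element below is lemma \<open>greatest_filter_imp\<close>.
\<close>

definition filter_imp :: "'a set \<Rightarrow> 'a set set \<Rightarrow> 'a set set \<Rightarrow> 'a set set"
  where "filter_imp X F G = (THE H. greatest (Filt X) H {H \<in> filters_on X. H \<inter> F \<subseteq> G})"

definition filter_neg :: "'a set \<Rightarrow> 'a set set \<Rightarrow> 'a set set"
  where "filter_neg X F = filter_imp X F {X}"

definition nn_dense :: "'a set \<Rightarrow> 'a set set \<Rightarrow> bool"
  where "nn_dense X F \<longleftrightarrow> filter_neg X (filter_neg X F) = Pow X"

definition nn_filters :: "'a set \<Rightarrow> 'a set set set"
  where "nn_filters X = {F \<in> filters_on X. filter_neg X (filter_neg X F) = F}"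

definition left_adjoint ::
  "'a gorder \<Rightarrow> 'b gorder \<Rightarrow> ('a \<Rightarrow> 'b) \<Rightarrow> ('b \<Rightarrow> 'a) \<Rightarrow> bool"
  where "left_adjoint P Q f g \<longleftrightarrow>
    galois_connection \<lparr>orderA = P, orderB = Q, lower = f, upper = g\<rparr>"

definition monotone_map :: "'a gorder \<Rightarrow> 'b gorder \<Rightarrow> ('a \<Rightarrow> 'b) \<Rightarrow> bool"
  where "monotone_map P Q f \<longleftrightarrow> f \<in> carrier P \<rightarrow> carrier Q \<and> isotone P Q f"

definition order_isomorphic :: "'a gorder \<Rightarrow> 'b gorder \<Rightarrow> bool"
  where "order_isomorphic P Q \<longleftrightarrow>
    (\<exists>f. bij_betw f (carrier P) (carrier Q) \<and> order_emb P Q f)"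

lemma inclusion_order_simps [simp]:
  "carrier (inclusion_order S) = S"
  "eq (inclusion_order S) = (=)"
  "le (inclusion_order S) = (\<subseteq>)"
  by (simp_all add: inclusion_order_def)

lemma partial_order_inclusion_order: "partial_order (inclusion_order S)"
  by unfold_locales auto

lemma filters_onD:
  assumes "F \<in> filters_on X"
  shows "U \<in> F \<Longrightarrow> U \<subseteq> X"
    and "X \<in> F"
    and "U \<in> F \<Longrightarrow> V \<in> F \<Longrightarrow> U \<inter> V \<in> F"
    and "U \<in> F \<Longrightarrow> U \<subseteq> V \<Longrightarrow> V \<subseteq> X \<Longrightarrow> V \<in> F"
proof -
  have sub: "F \<subseteq> Pow X" and ne: "F \<noteq> {}" and int: "\<forall>U\<in>F. \<forall>V\<in>F. U \<inter> V \<in> F"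
    and up: "\<forall>U\<in>F. \<forall>V. U \<subseteq> V \<and> V \<subseteq> X \<longrightarrow> V \<in> F"
    using assms by (simp_all add: filters_on_def)
  show "U \<in> F \<Longrightarrow> U \<subseteq> X" using sub by (meson PowD subsetD)
  obtain W where W: "W \<in> F" using ne by (meson ex_in_conv)
  then have "W \<subseteq> X" using sub by (meson PowD subsetD)
  then show "X \<in> F" using up W by simp
  show "U \<in> F \<Longrightarrow> V \<in> F \<Longrightarrow> U \<inter> V \<in> F" using int by simp
  show "U \<in> F \<Longrightarrow> U \<subseteq> V \<Longrightarrow> V \<subseteq> X \<Longrightarrow> V \<in> F" using up by simp
qed

lemma filters_onI:
  assumes "\<And>U. U \<in> F \<Longrightarrow> U \<subseteq> X"
    and "X \<in> F"
    and "\<And>U V. U \<in> F \<Longrightarrow> V \<in> F \<Longrightarrow> U \<inter> V \<in> F"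
    and "\<And>U V. U \<in> F \<Longrightarrow> U \<subseteq> V \<Longrightarrow> V \<subseteq> X \<Longrightarrow> V \<in> F"
  shows "F \<in> filters_on X"
proof -
  have "F \<subseteq> Pow X" using assms(1) by (simp add: subset_iff)
  moreover have "F \<noteq> {}" using assms(2) by (meson empty_iff)
  moreover have "\<forall>U\<in>F. \<forall>V\<in>F. U \<inter> V \<in> F" using assms(3) by simp
  moreover have "\<forall>U\<in>F. \<forall>V. U \<subseteq> V \<and> V \<subseteq> X \<longrightarrow> V \<in> F" using assms(4) by (meson)
  ultimately show ?thesis by (simp add: filters_on_def)
qed

lemma filters_on_imp_witness:
  assumes F: "F \<in> filters_on X" and G: "G \<in> filters_on X"
  shows "{A. A \<subseteq> X \<and> (\<forall>B\<in>F. A \<union> B \<in> G)} \<in> filters_on X"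
proof (rule filters_onI)
  fix U assume "U \<in> {A. A \<subseteq> X \<and> (\<forall>B\<in>F. A \<union> B \<in> G)}"
  then show "U \<subseteq> X" by simp
next
  show "X \<in> {A. A \<subseteq> X \<and> (\<forall>B\<in>F. A \<union> B \<in> G)}"
    using filters_onD(1)[OF F] filters_onD(2)[OF G] by (simp add: Un_absorb2)
next
  fix U V
  assume "U \<in> {A. A \<subseteq> X \<and> (\<forall>B\<in>F. A \<union> B \<in> G)}"
    "V \<in> {A. A \<subseteq> X \<and> (\<forall>B\<in>F. A \<union> B \<in> G)}"
  then show "U \<inter> V \<in> {A. A \<subseteq> X \<and> (\<forall>B\<in>F. A \<union> B \<in> G)}"
    using filters_onD(3)[OF G] by (simp add: Un_Int_distrib2 le_infI1)
next
  fix U V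
  assume U: "U \<in> {A. A \<subseteq> X \<and> (\<forall>B\<in>F. A \<union> B \<in> G)}" and UV: "U \<subseteq> V" and V: "V \<subseteq> X"
  have "V \<union> B \<in> G" if B: "B \<in> F" for B
  proof (rule filters_onD(4)[OF G])
    show "U \<union> B \<in> G" using U B by simp
    show "U \<union> B \<subseteq> V \<union> B" using UV by (rule Un_mono[OF _ subset_refl])
    show "V \<union> B \<subseteq> X" using V filters_onD(1)[OF F B] by simp
  qed
  then show "V \<in> {A. A \<subseteq> X \<and> (\<forall>B\<in>F. A \<union> B \<in> G)}" using V by simp
qed

lemma greatest_filter_imp:
  assumes F: "F \<in> filters_on X" and G: "G \<in> filters_on X"
  shows "greatest (Filt X) (filter_imp X F G) {H \<in> filters_on X. H \<inter> F \<subseteq> G}"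
proof -
  define W where "W = {A. A \<subseteq> X \<and> (\<forall>B\<in>F. A \<union> B \<in> G)}"
  have W: "W \<in> filters_on X"
    unfolding W_def by (rule filters_on_imp_witness[OF F G])
  have WF: "W \<inter> F \<subseteq> G"
  proof
    fix A assume "A \<in> W \<inter> F"
    then have "A \<in> F" and "\<forall>B\<in>F. A \<union> B \<in> G" by (simp_all add: W_def)
    then have "A \<union> A \<in> G" by (rule bspec[rotated])
    then show "A \<in> G" by simp
  qed
  have max: "K \<subseteq> W" if K: "K \<in> filters_on X" and KF: "K \<inter> F \<subseteq> G" for K
  proof
    fix A assume A: "A \<in> K"
    have "A \<union> B \<in> G" if B: "B \<in> F" for B
    proof -
      have "A \<union> B \<subseteq> X" using filters_onD(1)[OF K A] filters_onD(1)[OF F B] by simp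
      then have "A \<union> B \<in> K" "A \<union> B \<in> F"
        using filters_onD(4)[OF K A] filters_onD(4)[OF F B] by simp_all
      then show ?thesis using KF by (meson IntI subsetD)
    qed
    then show "A \<in> W" unfolding W_def using filters_onD(1)[OF K A] by simp
  qed
  have *: "greatest (Filt X) W {H \<in> filters_on X. H \<inter> F \<subseteq> G}"
    unfolding greatest_def
  proof (intro conjI ballI)
    show "{H \<in> filters_on X. H \<inter> F \<subseteq> G} \<subseteq> carrier (Filt X)" by auto
    show "W \<in> {H \<in> filters_on X. H \<inter> F \<subseteq> G}" using W WF by (intro CollectI conjI)
  next
    fix K assume "K \<in> {H \<in> filters_on X. H \<inter> F \<subseteq> G}"
    then have "K \<in> filters_on X \<and> K \<inter> F \<subseteq> G" by (rule CollectD)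
    then have "K \<subseteq> W" by (elim conjE) (rule max)
    then show "le (Filt X) K W" by (simp only: inclusion_order_simps)
  qed
  have "filter_imp X F G = W"
    unfolding filter_imp_def
  proof (rule the_equality)
    show "greatest (Filt X) W {H \<in> filters_on X. H \<inter> F \<subseteq> G}" by (rule *)
  next
    fix H assume H: "greatest (Filt X) H {H \<in> filters_on X. H \<inter> F \<subseteq> G}"
    show "H = W"
      by (rule partial_order.greatest_unique[OF partial_order_inclusion_order H *])
  qed
  then show ?thesis using * by (simp only:)
qed

end

theory Submission
  imports Defs
begin

text \<open>
  The properties of cofinite sets rest on one finiteness argument: a cofinite set \<open>V\<close> belongs to a filter
  \<open>F\<close> as soon as it contains the limit of \<open>F\<close>. Each of the finitely many points outside
  \<open>V\<close> is missed by some member of \<open>F\<close>, and the intersection of these members lies in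
  \<open>V\<close>. Hence, on cofinite sets, \<open>F\<close> is determined by its limit
  (\<open>cofinite_up_filter_limit\<close>), which yields the adjunction between the cofinite filters and
  the limit, the Frobenius relation, and the description of the filters below the cofinite filter.
  The adjunction between the limit and the principal filters is purely formal.

  For the implications, \<open>A\<close> lies in \<open>F \<rightarrow> G\<close> iff \<open>A \<union> B \<in> G\<close> for every
  \<open>B \<in> F\<close>. When \<open>G\<close> is the least filter this says that \<open>B\<close> covers the complement of
  \<open>A\<close> for every \<open>B \<in> F\<close>, so the negation of \<open>F\<close> is the principal filter of the
  complement of its limit, and the double negation is the principal filter of the limit itself.
  When \<open>F\<close> is the cofinite filter, every \<open>A \<union> B\<close> is cofinite, so by the finiteness argument
  the condition only involves the limit of \<open>G\<close>, and testing it on complements of points gives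
  the principal filter of that limit again. Density and the two isomorphisms follow, since a principal
  filter is improper exactly when it is generated by the empty set, and \<open>A\<close> is recovered as
  the limit of both of its associated filters.
\<close>

section \<open>Adjoints and isomorphisms of partial orders\<close>

lemma partial_order_inv_inclusion_order: "partial_order (inv_gorder (inclusion_order S))"
  by (rule partial_order.dual_order[OF partial_order_inclusion_order])

lemma left_adjoint_monotone_maps:
  assumes "left_adjoint P Q f g"
  shows "monotone_map P Q f" and "monotone_map Q P g"
proof -
  interpret galois_connection "\<lparr>orderA = P, orderB = Q, lower = f, upper = g\<rparr>"
    using assms by (simp only: left_adjoint_def)
  show "monotone_map P Q f"
    using lower_closure lower_iso by (simp add: monotone_map_def)
  show "monotone_map Q P g"
    using upper_closure upper_iso by (simp add: monotone_map_def)
qed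

lemma left_adjointI:
  assumes "partial_order P" "partial_order Q"
    and "f \<in> carrier P \<rightarrow> carrier Q" "g \<in> carrier Q \<rightarrow> carrier P"
    and "\<And>p q. \<lbrakk>p \<in> carrier P; q \<in> carrier Q\<rbrakk> \<Longrightarrow> le Q (f p) q \<longleftrightarrow> le P p (g q)"
  shows "left_adjoint P Q f g"
  unfolding left_adjoint_def
  using assms by (intro galois_connection.intro connection.intro galois_connection_axioms.intro) simp_all

lemma order_isomorphicI:
  assumes P: "partial_order P" and Q: "partial_order Q"
    and f: "f \<in> carrier P \<rightarrow> carrier Q" and g: "g \<in> carrier Q \<rightarrow> carrier P"
    and gf: "\<And>p. p \<in> carrier P \<Longrightarrow> g (f p) = p"
    and fg: "\<And>q. q \<in> carrier Q \<Longrightarrow> f (g q) = q"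
    and f_mono: "\<And>p p'. \<lbrakk>p \<in> carrier P; p' \<in> carrier P; le P p p'\<rbrakk> \<Longrightarrow> le Q (f p) (f p')"
    and g_mono: "\<And>q q'. \<lbrakk>q \<in> carrier Q; q' \<in> carrier Q; le Q q q'\<rbrakk> \<Longrightarrow> le P (g q) (g q')"
  shows "order_isomorphic P Q"
  unfolding order_isomorphic_def
proof (intro exI conjI)
  show "bij_betw f (carrier P) (carrier Q)"
    using f g gf fg by (intro bij_betwI[where g = g]) auto
  have "le P p p'" if "p \<in> carrier P" "p' \<in> carrier P" "le Q (f p) (f p')" for p p'
  proof -
    have "le P (g (f p)) (g (f p'))"
      using that f by (intro g_mono) auto
    then show ?thesis using that gf by simp
  qed
  then show "order_emb P Q f"
    using f_mono P Q by (auto simp: order_emb_def partial_order_def)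
qed

section \<open>Limits and the filters attached to a subset\<close>

lemma up_filter_in_filters: "A \<subseteq> X \<Longrightarrow> up_filter X A \<in> filters_on X"
  by (rule filters_onI) (auto simp: up_filter_def)

lemma cofinite_filter_in_filters: "cofinite_filter X \<in> filters_on X"
proof (rule filters_onI)
  fix U V assume "U \<in> cofinite_filter X" "V \<in> cofinite_filter X"
  then show "U \<inter> V \<in> cofinite_filter X"
    by (auto simp: cofinite_filter_def Diff_Int)
next
  fix U V assume "U \<in> cofinite_filter X" "U \<subseteq> V" "V \<subseteq> X"
  then show "V \<in> cofinite_filter X"
    by (auto simp: cofinite_filter_def intro: finite_subset[OF Diff_mono[OF subset_refl]])
qed (auto simp: cofinite_filter_def)

lemma filters_on_Int:
  "F \<in> filters_on X \<Longrightarrow> G \<in> filters_on X \<Longrightarrow> F \<inter> G \<in> filters_on X"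
  by (rule filters_onI) (auto dest: filters_onD)

lemma cofinite_up_filter_in_filters: "A \<subseteq> X \<Longrightarrow> cofinite_up_filter X A \<in> filters_on X"
  unfolding cofinite_up_filter_def
  by (intro filters_on_Int cofinite_filter_in_filters up_filter_in_filters)

lemma cofinite_up_filter_le_cofinite: "cofinite_up_filter X A \<subseteq> cofinite_filter X"
  by (simp add: cofinite_up_filter_def)

lemma filter_limit_subset: "F \<in> filters_on X \<Longrightarrow> filter_limit F \<subseteq> X"
  by (auto simp: filter_limit_def dest: filters_onD(2))

lemma filter_limit_antimono: "F \<subseteq> G \<Longrightarrow> filter_limit G \<subseteq> filter_limit F"
  by (auto simp: filter_limit_def)

lemma up_filter_antimono: "A \<subseteq> B \<Longrightarrow> up_filter X B \<subseteq> up_filter X A"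
  by (auto simp: up_filter_def)

lemma cofinite_up_filter_antimono:
  "A \<subseteq> B \<Longrightarrow> cofinite_up_filter X B \<subseteq> cofinite_up_filter X A"
  using up_filter_antimono[of A B X] by (auto simp: cofinite_up_filter_def)

lemma filter_limit_up_filter: "A \<subseteq> X \<Longrightarrow> filter_limit (up_filter X A) = A"
  by (auto simp: filter_limit_def up_filter_def)

text \<open>The complements of single points are cofinite and already cut \<open>X\<close> down to \<open>A\<close>.\<close>

lemma filter_limit_cofinite_up_filter:
  assumes "A \<subseteq> X"
  shows "filter_limit (cofinite_up_filter X A) = A"
proof
  show "A \<subseteq> filter_limit (cofinite_up_filter X A)"
    by (auto simp: filter_limit_def cofinite_up_filter_def up_filter_def)
  show "filter_limit (cofinite_up_filter X A) \<subseteq> A"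
  proof
    fix x assume x: "x \<in> filter_limit (cofinite_up_filter X A)"
    have "x \<in> X"
      using x filter_limit_subset[OF cofinite_up_filter_in_filters[OF assms]] by blast
    show "x \<in> A"
    proof (rule ccontr)
      assume "x \<notin> A"
      then have "X - {x} \<in> cofinite_up_filter X A"
        using assms \<open>x \<in> X\<close>
        by (auto simp: cofinite_up_filter_def cofinite_filter_def up_filter_def double_diff)
      then show False using x by (auto simp: filter_limit_def)
    qed
  qed
qed

lemma filters_on_finite_Inter:
  assumes "F \<in> filters_on X" and "finite I" and "\<And>i. i \<in> I \<Longrightarrow> B i \<in> F"
  shows "X \<inter> (\<Inter>i\<in>I. B i) \<in> F"
  using assms(2,3)
proof (induction I rule: finite_induct)
  case empty
  then show ?case using filters_onD(2)[OF assms(1)] by simp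
next
  case (insert i I)
  then have "X \<inter> (\<Inter>i\<in>I. B i) \<in> F" and "B i \<in> F" by simp_all
  then have "B i \<inter> (X \<inter> (\<Inter>i\<in>I. B i)) \<in> F"
    by (metis filters_onD(3)[OF assms(1)])
  then show ?case by (simp add: Int_left_commute)
qed

text \<open>
  The finiteness argument: choosing for each of the finitely many points outside \<open>V\<close> a
  member of \<open>F\<close> that misses it, the intersection of the chosen members is contained in
  \<open>V\<close>.
\<close>

lemma cofinite_mem_filter_iff:
  assumes F: "F \<in> filters_on X" and V: "V \<in> cofinite_filter X"
  shows "V \<in> F \<longleftrightarrow> filter_limit F \<subseteq> V"
proof
  assume "V \<in> F"
  then show "filter_limit F \<subseteq> V" by (auto simp: filter_limit_def)
next
  assume lim: "filter_limit F \<subseteq> V"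
  have VX: "V \<subseteq> X" and fin: "finite (X - V)"
    using V by (simp_all add: cofinite_filter_def)
  have "\<exists>U\<in>F. x \<notin> U" if "x \<in> X - V" for x
    using lim that by (auto simp: filter_limit_def)
  then obtain B where B: "\<And>x. x \<in> X - V \<Longrightarrow> B x \<in> F \<and> x \<notin> B x"
    by metis
  have "X \<inter> (\<Inter>x\<in>X - V. B x) \<in> F"
    using B by (intro filters_on_finite_Inter[OF F fin]) blast
  moreover have "X \<inter> (\<Inter>x\<in>X - V. B x) \<subseteq> V"
    using B by blast
  ultimately show "V \<in> F"
    using VX by (rule filters_onD(4)[OF F])
qed

lemma cofinite_up_filter_limit:
  assumes "F \<in> filters_on X"
  shows "cofinite_up_filter X (filter_limit F) = cofinite_filter X \<inter> F"
  using cofinite_mem_filter_iff[OF assms] filters_onD(1)[OF assms]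
  by (auto simp: cofinite_up_filter_def up_filter_def cofinite_filter_def)

lemma cofinite_up_filter_frobenius:
  assumes "F \<in> filters_on X"
  shows "cofinite_up_filter X (A \<union> filter_limit F) = cofinite_up_filter X A \<inter> F"
proof -
  have "cofinite_up_filter X (A \<union> filter_limit F)
      = cofinite_up_filter X A \<inter> cofinite_up_filter X (filter_limit F)"
    by (auto simp: cofinite_up_filter_def up_filter_def)
  then show ?thesis
    using cofinite_up_filter_limit[OF assms] cofinite_up_filter_le_cofinite[of X A] by blast
qed

lemma cofinite_up_filter_left_adjoint:
  "left_adjoint (Pow_op X) (Filt X) (cofinite_up_filter X) filter_limit"
proof (rule left_adjointI[OF partial_order_inv_inclusion_order
      partial_order_inclusion_order])
  fix A F assume "A \<in> carrier (Pow_op X)" "F \<in> carrier (Filt X)"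
  then have A: "A \<subseteq> X" and F: "F \<in> filters_on X" by simp_all
  have "cofinite_up_filter X A \<subseteq> F" if "filter_limit F \<subseteq> A"
    using cofinite_up_filter_antimono[OF that, of X] cofinite_up_filter_limit[OF F] by blast
  moreover have "filter_limit F \<subseteq> A" if "cofinite_up_filter X A \<subseteq> F"
    using filter_limit_antimono[OF that] filter_limit_cofinite_up_filter[OF A] by simp
  ultimately show "le (Filt X) (cofinite_up_filter X A) F
      \<longleftrightarrow> le (Pow_op X) A (filter_limit F)"
    by auto
qed (auto intro: cofinite_up_filter_in_filters dest: filter_limit_subset)

lemma filter_limit_left_adjoint:
  "left_adjoint (Filt X) (Pow_op X) filter_limit (up_filter X)"
proof (rule left_adjointI[OF partial_order_inclusion_order
      partial_order_inv_inclusion_order])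
  fix F A assume "F \<in> carrier (Filt X)" "A \<in> carrier (Pow_op X)"
  then show "le (Pow_op X) (filter_limit F) A \<longleftrightarrow> le (Filt X) F (up_filter X A)"
    by (auto simp: filter_limit_def up_filter_def dest: filters_onD(1))
qed (auto intro: up_filter_in_filters dest: filter_limit_subset)

section \<open>Implication and double negation\<close>

text \<open>
  The implication is specified as a greatest element; the elementwise description
  comes from the fact that the filter of all \<open>A\<close> below is the greatest one.
\<close>

lemma filter_imp_eq:
  assumes F: "F \<in> filters_on X" and G: "G \<in> filters_on X"
  shows "filter_imp X F G = {A. A \<subseteq> X \<and> (\<forall>B\<in>F. A \<union> B \<in> G)}" (is "?H = ?W")
proof
  have great: "greatest (Filt X) ?H {H \<in> filters_on X. H \<inter> F \<subseteq> G}"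
    by (rule greatest_filter_imp[OF F G])
  then have H: "?H \<in> filters_on X" and HF: "?H \<inter> F \<subseteq> G"
    by (simp_all add: greatest_def)
  show "?H \<subseteq> ?W"
  proof
    fix A assume A: "A \<in> ?H"
    have "A \<union> B \<in> G" if B: "B \<in> F" for B
    proof -
      have "A \<union> B \<subseteq> X" using filters_onD(1)[OF H A] filters_onD(1)[OF F B] by simp
      then have "A \<union> B \<in> ?H \<inter> F"
        using filters_onD(4)[OF H A] filters_onD(4)[OF F B] by simp
      then show ?thesis using HF by blast
    qed
    then show "A \<in> ?W" using filters_onD(1)[OF H A] by simp
  qed
  have "?W \<inter> F \<subseteq> G"
  proof
    fix A assume "A \<in> ?W \<inter> F"
    then have "A \<union> A \<in> G" by blast
    then show "A \<in> G" by simp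
  qed
  then show "?W \<subseteq> ?H"
    using great filters_on_imp_witness[OF F G] by (auto simp: greatest_def)
qed

lemma filter_neg_eq_up_filter:
  assumes F: "F \<in> filters_on X"
  shows "filter_neg X F = up_filter X (X - filter_limit F)"
proof -
  have bot: "{X} \<in> filters_on X" by (rule filters_onI) auto
  have "(\<forall>B\<in>F. A \<union> B = X) \<longleftrightarrow> X - filter_limit F \<subseteq> A" if "A \<subseteq> X" for A
    using that filters_onD(1)[OF F] unfolding filter_limit_def by blast
  then show ?thesis
    by (auto simp: filter_neg_def filter_imp_eq[OF F bot] up_filter_def)
qed

lemma filter_double_neg_eq_up_filter_limit:
  assumes F: "F \<in> filters_on X"
  shows "filter_neg X (filter_neg X F) = up_filter X (filter_limit F)"
proof -
  have "filter_neg X (filter_neg X F)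
      = up_filter X (X - filter_limit (up_filter X (X - filter_limit F)))"
    by (simp add: filter_neg_eq_up_filter[OF F] filter_neg_eq_up_filter up_filter_in_filters)
  also have "\<dots> = up_filter X (filter_limit F)"
    using filter_limit_subset[OF F] by (simp add: filter_limit_up_filter double_diff)
  finally show ?thesis .
qed

text \<open>
  Since every \<open>A \<union> B\<close> with \<open>B\<close> cofinite is cofinite, its membership in \<open>F\<close> depends
  on the limit of \<open>F\<close> only.
\<close>

lemma filter_imp_cofinite_eq_up_filter_limit:
  assumes F: "F \<in> filters_on X"
  shows "filter_imp X (cofinite_filter X) F = up_filter X (filter_limit F)"
proof -
  have "(\<forall>B\<in>cofinite_filter X. A \<union> B \<in> F) \<longleftrightarrow> filter_limit F \<subseteq> A" if A: "A \<subseteq> X" for A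
  proof -
    have "(\<forall>B\<in>cofinite_filter X. A \<union> B \<in> F)
        \<longleftrightarrow> (\<forall>B\<in>cofinite_filter X. filter_limit F \<subseteq> A \<union> B)"
    proof (rule ball_cong[OF refl])
      fix B assume B: "B \<in> cofinite_filter X"
      have "A \<union> B \<in> cofinite_filter X"
        using A filters_onD(1)[OF cofinite_filter_in_filters B]
        by (intro filters_onD(4)[OF cofinite_filter_in_filters B]) auto
      then show "A \<union> B \<in> F \<longleftrightarrow> filter_limit F \<subseteq> A \<union> B"
        by (rule cofinite_mem_filter_iff[OF F])
    qed
    also have "\<dots> \<longleftrightarrow> filter_limit F \<subseteq> A"
    proof
      assume cov: "\<forall>B\<in>cofinite_filter X. filter_limit F \<subseteq> A \<union> B"
      show "filter_limit F \<subseteq> A"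
      proof
        fix x assume x: "x \<in> filter_limit F"
        \<comment> \<open>The cofinite set \<open>X - {x}\<close> cannot account for \<open>x\<close>, so \<open>A\<close> must.\<close>
        have "X - {x} \<in> cofinite_filter X"
          using filter_limit_subset[OF F] x by (auto simp: cofinite_filter_def double_diff)
        then show "x \<in> A" using cov x by blast
      qed
    qed blast
    finally show ?thesis .
  qed
  then show ?thesis
    by (auto simp: filter_imp_eq[OF cofinite_filter_in_filters F] up_filter_def)
qed

lemma nn_dense_iff_limit_empty:
  assumes "F \<in> filters_on X"
  shows "nn_dense X F \<longleftrightarrow> filter_limit F = {}"
  by (auto simp: nn_dense_def filter_double_neg_eq_up_filter_limit[OF assms] up_filter_def)

section \<open>The two copies of the opposite powerset\<close>

text \<open>
  An adjunction restricts to an isomorphism between its fixed elements. For the adjunction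
  with principal filters these are the double-negation closed filters.
\<close>

lemma nn_filters_isomorphic_Pow_op:
  "order_isomorphic (inclusion_order (nn_filters X)) (Pow_op X)"
proof (rule order_isomorphicI[where f = filter_limit and g = "up_filter X",
      OF partial_order_inclusion_order partial_order_inv_inclusion_order])
  show "filter_limit \<in> carrier (inclusion_order (nn_filters X)) \<rightarrow> carrier (Pow_op X)"
    by (simp add: nn_filters_def filter_limit_subset)
next
  show "up_filter X \<in> carrier (Pow_op X) \<rightarrow> carrier (inclusion_order (nn_filters X))"
    by (simp add: nn_filters_def up_filter_in_filters filter_double_neg_eq_up_filter_limit
        filter_limit_up_filter)
next
  fix F G assume "le (inclusion_order (nn_filters X)) F G"
  then show "le (Pow_op X) (filter_limit F) (filter_limit G)"
    by (simp add: filter_limit_antimono)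
next
  fix A B assume "le (Pow_op X) A B"
  then show "le (inclusion_order (nn_filters X)) (up_filter X A) (up_filter X B)"
    by (simp add: up_filter_antimono)
next
  fix F assume "F \<in> carrier (inclusion_order (nn_filters X))"
  then have "F \<in> filters_on X" and "filter_neg X (filter_neg X F) = F"
    by (simp_all add: nn_filters_def)
  then show "up_filter X (filter_limit F) = F"
    by (metis filter_double_neg_eq_up_filter_limit)
next
  fix A assume "A \<in> carrier (Pow_op X)"
  then show "filter_limit (up_filter X A) = A"
    by (simp add: filter_limit_up_filter)
qed

text \<open>
  For the adjunction with cofinite filters, the fixed elements are the filters below the cofinite
  filter, because such a filter is determined by its limit.
\<close>

lemma Pow_op_isomorphic_cofinite_subfilters:
  "order_isomorphic (Pow_op X)
     (inclusion_order {F \<in> filters_on X. F \<subseteq> cofinite_filter X})"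
proof (rule order_isomorphicI[where f = "cofinite_up_filter X" and g = filter_limit,
      OF partial_order_inv_inclusion_order partial_order_inclusion_order])
  fix F assume "F \<in> carrier (inclusion_order {F \<in> filters_on X. F \<subseteq> cofinite_filter X})"
  then show "cofinite_up_filter X (filter_limit F) = F"
    by (simp add: cofinite_up_filter_limit Int_absorb1)
next
  show "cofinite_up_filter X
      \<in> carrier (Pow_op X)
        \<rightarrow> carrier (inclusion_order {F \<in> filters_on X. F \<subseteq> cofinite_filter X})"
    by (simp add: cofinite_up_filter_le_cofinite cofinite_up_filter_in_filters)
next
  fix A B assume "le (Pow_op X) A B"
  then show "le (inclusion_order {F \<in> filters_on X. F \<subseteq> cofinite_filter X})
      (cofinite_up_filter X A) (cofinite_up_filter X B)"
    by (simp add: cofinite_up_filter_antimono)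
next
  fix F G assume "le (inclusion_order {F \<in> filters_on X. F \<subseteq> cofinite_filter X}) F G"
  then show "le (Pow_op X) (filter_limit F) (filter_limit G)"
    by (simp add: filter_limit_antimono)
next
  fix A assume "A \<in> carrier (Pow_op X)"
  then show "filter_limit (cofinite_up_filter X A) = A"
    by (simp add: filter_limit_cofinite_up_filter)
next
  show "filter_limit
      \<in> carrier (inclusion_order {F \<in> filters_on X. F \<subseteq> cofinite_filter X})
        \<rightarrow> carrier (Pow_op X)"
    by (simp add: filter_limit_subset)
qed

section \<open>The adjoint triple and double negation\<close>

theorem theorem1p7:
  fixes X :: "'a set"
  shows
    \<comment> \<open>monotonicity\<close>
    "monotone_map (Pow_op X) (Filt X) (cofinite_up_filter X)
     \<and> monotone_map (Pow_op X) (Filt X) (up_filter X)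
     \<and> monotone_map (Filt X) (Pow_op X) filter_limit
     \<comment> \<open>(i)\<close>
     \<and> (\<forall>A\<in>Pow X. (filter_limit \<circ> cofinite_up_filter X) A = A
                 \<and> (filter_limit \<circ> up_filter X) A = A)
     \<comment> \<open>(ii)\<close>
     \<and> left_adjoint (Pow_op X) (Filt X) (cofinite_up_filter X) filter_limit
     \<and> left_adjoint (Filt X) (Pow_op X) filter_limit (up_filter X)
     \<comment> \<open>(iii)\<close>
     \<and> (\<forall>A\<in>Pow X. \<forall>F\<in>filters_on X.
          cofinite_up_filter X (A \<union> filter_limit F) = cofinite_up_filter X A \<inter> F)
     \<comment> \<open>(iv)\<close>
     \<and> (\<forall>F\<in>filters_on X.
          (up_filter X \<circ> filter_limit) F = filter_imp X (cofinite_filter X) F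
          \<and> filter_imp X (cofinite_filter X) F = filter_neg X (filter_neg X F))
     \<comment> \<open>(v)\<close>
     \<and> (\<forall>F\<in>filters_on X. nn_dense X F \<longleftrightarrow> filter_limit F = {})
     \<comment> \<open>(vi)\<close>
     \<and> order_isomorphic (inclusion_order (nn_filters X)) (Pow_op X)
     \<and> order_isomorphic (Pow_op X)
          (inclusion_order {F \<in> filters_on X. F \<subseteq> cofinite_filter X})"
  using left_adjoint_monotone_maps[OF cofinite_up_filter_left_adjoint[of X]]
    left_adjoint_monotone_maps[OF filter_limit_left_adjoint[of X]]
  by (intro conjI ballI)
    (simp_all only: PowD comp_apply filter_limit_cofinite_up_filter filter_limit_up_filter
      cofinite_up_filter_left_adjoint filter_limit_left_adjoint cofinite_up_filter_frobenius
      filter_imp_cofinite_eq_up_filter_limit filter_double_neg_eq_up_filter_limit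
      nn_dense_iff_limit_empty nn_filters_isomorphic_Pow_op
      Pow_op_isomorphic_cofinite_subfilters)

end
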